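(* Let $\gamma,\delta\in\mathbb{R}$, let $\alpha$ be an irrational real number such that $\|n\alpha-\gamma\|>0$ for all $n\in\mathbb{N}$, and let $\psi:\mathbb{N}\to(0,+\infty)$ be such that the sum $\sum_{n=1}^\infty\psi(n)\log n$ converges. Furthermore, assume that at least one of the following two conditions holds: (i) $n\mapsto n\psi(n)$ is decreasing and there is a constant $C>0$ such that $S_N(\alpha,\gamma)\le C(\log N)^2$ for all integers $N\ge 2$; (ii) $n\mapsto\psi(n)$ is decreasing and there is a constant $C>0$ such that $R_N(\alpha,\gamma)\le C\,N\log N$ for all integers $N\ge 2$. Then for almost all $\beta\in\mathbb{R}$ (with respect to Lebesgue measure) there exist only finitely many $n\in\mathbb{N}$ such that $$\|n\alpha-\gamma\|\,\|n\beta-\delta\|<\psi(n).$$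
   Context: $\|x\|$ denotes the distance from $x\in\mathbb{R}$ to the nearest integer. $S_N(\alpha,\gamma):=\sum_{n=1}^N\frac{1}{n\|n\alpha-\gamma\|}$ and $R_N(\alpha,\gamma):=\sum_{n=1}^N\frac{1}{\|n\alpha-\gamma\|}$. *)

theory Defs
  imports "HOL-Analysis.Analysis"
begin

definition dist_nearest_int :: "real \<Rightarrow> real" where
  "dist_nearest_int x = infdist x \<int>"

definition S_sum :: "nat \<Rightarrow> real \<Rightarrow> real \<Rightarrow> real" where
  "S_sum N \<alpha> \<gamma> = (\<Sum>n = 1..N. 1 / (real n * dist_nearest_int (real n * \<alpha> - \<gamma>)))"

definition R_sum :: "nat \<Rightarrow> real \<Rightarrow> real \<Rightarrow> real" where
  "R_sum N \<alpha> \<gamma> = (\<Sum>n = 1..N. 1 / dist_nearest_int (real n * \<alpha> - \<gamma>))"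

end

theory Submission
  imports Defs
begin

text \<open>
  Write \<open>d\<close> for the distance to the nearest integer. The inequality in the conclusion reads
  \<open>d (n\<beta> - \<delta>) < \<epsilon> n\<close> with \<open>\<epsilon> n = \<psi> n / d (n\<alpha> - \<gamma>)\<close>. If \<open>\<epsilon>\<close> is bounded, the
  solutions \<open>\<beta>\<close> within a bounded interval form a set of measure \<open>O(\<epsilon> n)\<close>, since they lie in
  \<open>O(n)\<close> intervals of length \<open>2 * \<epsilon> n / n\<close>. By the Borel-Cantelli lemma
  (\<open>AE_finite_inhomogeneous_approximations\<close>) it is therefore enough that \<open>\<epsilon>\<close> be summable.

  This is what the two conditions provide, through partial summation. In both of them \<open>\<epsilon> n\<close> is
  written as \<open>\<phi> n * w n\<close> with \<open>\<phi>\<close> decreasing: \<open>\<phi> n = n * \<psi> n\<close> and \<open>w n = 1 / (n * d (n\<alpha> - \<gamma>))\<close> in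
  the first, \<open>\<phi> = \<psi>\<close> and \<open>w n = 1 / d (n\<alpha> - \<gamma>)\<close> in the second. Against a decreasing weight, a
  bound \<open>G N\<close> on the partial sums of \<open>w\<close> acts as if it were the termwise bound
  \<open>w n \<le> G n - G (n - 1)\<close> (\<open>summable_antimono_weight\<close>). The increments of \<open>(ln n)\<^sup>2\<close> and
  \<open>n * ln n\<close> are \<open>O(ln n / n)\<close> and \<open>O(ln n)\<close>, so in either case the resulting
  majorant of \<open>\<epsilon> n\<close> is \<open>O(\<psi> n * ln n)\<close>, which is summable by hypothesis.
\<close>

section \<open>Borel-Cantelli for inhomogeneous approximation\<close>

lemma dist_nearest_int_attained: "\<exists>k::int. dist_nearest_int x = \<bar>x - of_int k\<bar>"
proof -
  have "\<exists>z\<in>\<int>. infdist x \<int> = dist x z"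
    using infdist_attains_inf[of "\<int> :: real set" x] closed_Ints Ints_0 by blast
  then show ?thesis
    by (auto simp: dist_nearest_int_def dist_real_def elim!: Ints_cases)
qed

text \<open>
  The convergence half of an inhomogeneous Khintchine theorem. The \<open>\<beta>\<close> with
  \<open>\<bar>n\<beta> - \<delta> - k\<bar> < \<epsilon> n\<close> for a given integer \<open>k\<close> form the ball of radius \<open>\<epsilon> n / n\<close> around
  \<open>(\<delta> + k) / n\<close>. Summability makes \<open>\<epsilon>\<close> bounded, so that only \<open>O(n)\<close> of these balls meet the
  interval \<open>[-M, M]\<close>, and their union has measure \<open>O(\<epsilon> n)\<close>.
\<close>

lemma AE_finite_inhomogeneous_approximations:
  fixes \<delta> :: real and \<epsilon> :: "nat \<Rightarrow> real"
  assumes nonneg: "\<And>n. n \<ge> 1 \<Longrightarrow> \<epsilon> n \<ge> 0"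
    and summable: "summable (\<lambda>n. \<epsilon> (Suc n))"
  shows "AE \<beta> in lebesgue. finite {n::nat. n \<ge> 1 \<and> dist_nearest_int (real n * \<beta> - \<delta>) < \<epsilon> n}"
proof -
  have "Bseq (\<lambda>n. \<epsilon> (Suc n))"
    using summable_LIMSEQ_zero[OF summable] by (intro convergent_imp_Bseq convergentI)
  then obtain B where "B > 0" and B: "\<And>n. \<bar>\<epsilon> (Suc n)\<bar> \<le> B"
    by (auto elim!: BseqE)
  have local: "AE \<beta> in lebesgue. \<bar>\<beta>\<bar> \<le> real M \<longrightarrow>
      finite {n::nat. n \<ge> 1 \<and> dist_nearest_int (real n * \<beta> - \<delta>) < \<epsilon> n}" for M :: nat
  proof -
    \<comment> \<open>For \<open>n + 1\<close> in place of \<open>n\<close>: a ball that meets \<open>[-M, M]\<close> belongs to some \<open>\<bar>k\<bar> \<le> L n\<close>.\<close>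
    define L where "L n = \<lfloor>real (Suc n) * real M + \<bar>\<delta>\<bar> + B\<rfloor>" for n
    define J where "J n k = ball ((\<delta> + of_int k) / real (Suc n)) (\<epsilon> (Suc n) / real (Suc n))"
      for n and k :: int
    define A where "A n = (\<Union>k\<in>{- L n..L n}. J n k)" for n
    define c where "c = 2 * (real M + \<bar>\<delta>\<bar> + B) + 1"
    have L_nonneg: "L n \<ge> 0" for n
      unfolding L_def zero_le_floor using \<open>B > 0\<close> by (intro add_nonneg_nonneg) auto
    have J_measurable: "J n k \<in> lmeasurable" for n k
      unfolding J_def by simp
    have A_measurable: "A n \<in> lmeasurable" for n
      unfolding A_def by (intro fmeasurable.finite_UN J_measurable) auto
    have J_measure: "measure lebesgue (J n k) = 2 * (\<epsilon> (Suc n) / real (Suc n))" for n k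
      using nonneg[of "Suc n"]
      by (simp add: J_def ball_eq_greaterThanLessThan measure_lborel_Ioo del: of_nat_Suc)
    have A_measure: "measure lebesgue (A n) \<le> 2 * c * \<epsilon> (Suc n)" for n
    proof -
      have "measure lebesgue (A n) \<le> (\<Sum>k\<in>{- L n..L n}. measure lebesgue (J n k))"
        unfolding A_def by (intro measure_UNION_le) (use J_measurable in \<open>auto simp: fmeasurableD\<close>)
      also have "\<dots> = (2 * real_of_int (L n) + 1) * (2 * (\<epsilon> (Suc n) / real (Suc n)))"
        using L_nonneg[of n] by (simp add: J_measure)
      also have "\<dots> \<le> (c * real (Suc n)) * (2 * (\<epsilon> (Suc n) / real (Suc n)))"
      proof (rule mult_right_mono)
        have "\<bar>\<delta>\<bar> + B \<le> (\<bar>\<delta>\<bar> + B) * real (Suc n)"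
          using \<open>B > 0\<close> by (simp add: algebra_simps)
        moreover have "real_of_int (L n) \<le> real (Suc n) * real M + \<bar>\<delta>\<bar> + B"
          unfolding L_def by (rule of_int_floor_le)
        ultimately show "2 * real_of_int (L n) + 1 \<le> c * real (Suc n)"
          by (simp add: c_def algebra_simps)
      qed (use nonneg[of "Suc n"] in simp)
      also have "\<dots> = 2 * c * \<epsilon> (Suc n)"
        by (simp del: of_nat_Suc)
      finally show ?thesis .
    qed
    have "summable (\<lambda>n. measure lebesgue (A n))"
      by (rule summable_comparison_test'[OF summable_mult[OF summable, of "2 * c"]])
        (use A_measure in auto)
    then have "AE \<beta> in lebesgue. \<forall>\<^sub>F n in sequentially. \<beta> \<in> space lebesgue - A n"
      using A_measurable
      by (intro borel_cantelli_AE1) (auto simp: fmeasurable_def simp del: emeasure_completion)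
    then show ?thesis
    proof (rule AE_mp, intro AE_I2 impI)
      fix \<beta> :: real
      assume avoid: "\<forall>\<^sub>F n in sequentially. \<beta> \<in> space lebesgue - A n" and bound: "\<bar>\<beta>\<bar> \<le> real M"
      obtain N where N: "\<And>n. n \<ge> N \<Longrightarrow> \<beta> \<notin> A n"
        using avoid by (auto simp: eventually_sequentially)
      have hit: "\<beta> \<in> A n" if "dist_nearest_int (real (Suc n) * \<beta> - \<delta>) < \<epsilon> (Suc n)" for n
      proof -
        obtain k :: int
          where "dist_nearest_int (real (Suc n) * \<beta> - \<delta>) = \<bar>real (Suc n) * \<beta> - \<delta> - of_int k\<bar>"
          using dist_nearest_int_attained by blast
        with that have k: "\<bar>real (Suc n) * \<beta> - \<delta> - of_int k\<bar> < \<epsilon> (Suc n)"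
          by simp
        have "\<bar>real (Suc n) * \<beta>\<bar> \<le> real (Suc n) * real M"
          unfolding abs_mult using bound by (intro mult_mono) auto
        then have "\<bar>real_of_int k\<bar> \<le> real (Suc n) * real M + \<bar>\<delta>\<bar> + B"
          using k B[of n] by linarith
        then have "\<bar>k\<bar> \<le> L n"
          by (simp add: L_def le_floor_iff)
        then have "k \<in> {- L n..L n}"
          by auto
        moreover have "\<beta> \<in> J n k"
        proof -
          have "(\<delta> + of_int k) / real (Suc n) - \<beta> = - (real (Suc n) * \<beta> - \<delta> - of_int k) / real (Suc n)"
            by (simp add: field_simps)
          then have "\<bar>(\<delta> + of_int k) / real (Suc n) - \<beta>\<bar>
              = \<bar>real (Suc n) * \<beta> - \<delta> - of_int k\<bar> / real (Suc n)"
            by (simp only: abs_divide abs_minus_cancel abs_of_nat)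
          also have "\<dots> < \<epsilon> (Suc n) / real (Suc n)"
            using k by (intro divide_strict_right_mono) auto
          finally show ?thesis
            by (simp add: J_def dist_real_def)
        qed
        ultimately show ?thesis
          by (auto simp: A_def)
      qed
      have "{n. n \<ge> 1 \<and> dist_nearest_int (real n * \<beta> - \<delta>) < \<epsilon> n} \<subseteq> {..N}"
      proof safe
        fix n :: nat
        assume "n \<ge> 1" and "dist_nearest_int (real n * \<beta> - \<delta>) < \<epsilon> n"
        then have "\<beta> \<in> A (n - 1)"
          using hit[of "n - 1"] by simp
        then show "n \<le> N"
          using N[of "n - 1"] by linarith
      qed
      then show "finite {n. n \<ge> 1 \<and> dist_nearest_int (real n * \<beta> - \<delta>) < \<epsilon> n}"
        by (rule finite_subset) simp
    qed
  qed
  have "AE \<beta> in lebesgue. \<forall>M::nat. \<bar>\<beta>\<bar> \<le> real M \<longrightarrow>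
      finite {n::nat. n \<ge> 1 \<and> dist_nearest_int (real n * \<beta> - \<delta>) < \<epsilon> n}"
    using local by (subst AE_all_countable) blast
  then show ?thesis
    by (rule AE_mp) (intro AE_I2 impI, use real_arch_simple in blast)
qed

section \<open>Partial summation against a decreasing weight\<close>

text \<open>
  Abel summation turns a bound \<open>G\<close> on the partial sums of \<open>w\<close> into one on the weighted sums. The
  induction carries the boundary term \<open>\<phi> N * (G N - w 0 - \<dots> - w N)\<close>; its second factor is
  nonnegative, so replacing \<open>\<phi> N\<close> by the smaller \<open>\<phi> (Suc N)\<close> costs nothing.
\<close>

lemma summable_antimono_weight:
  fixes \<phi> w g G :: "nat \<Rightarrow> real"
  assumes antimono: "\<And>n. \<phi> (Suc n) \<le> \<phi> n"
    and \<phi>_nonneg: "\<And>n. \<phi> n \<ge> 0" and w_nonneg: "\<And>n. w n \<ge> 0" and g_nonneg: "\<And>n. g n \<ge> 0"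
    and partial_sums: "\<And>N. (\<Sum>n\<le>N. w n) \<le> G N"
    and increments: "\<And>n. G (Suc n) - G n \<le> g (Suc n)"
    and summable: "summable (\<lambda>n. \<phi> n * g n)"
  shows "summable (\<lambda>n. \<phi> n * w n)"
proof -
  define W where "W N = (\<Sum>n\<le>N. w n)" for N
  have abel: "(\<Sum>n\<le>N. \<phi> n * w n) + \<phi> N * (G N - W N) \<le> \<phi> 0 * G 0 + (\<Sum>n\<le>N. \<phi> n * g n)" for N
  proof (induction N)
    case 0
    show ?case
      using \<phi>_nonneg[of 0] g_nonneg[of 0] by (simp add: W_def algebra_simps)
  next
    case (Suc N)
    have "\<phi> (Suc N) * (G N - W N) \<le> \<phi> N * (G N - W N)"
      using partial_sums[of N] by (intro mult_right_mono antimono) (simp add: W_def)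
    moreover have "\<phi> (Suc N) * (G (Suc N) - G N) \<le> \<phi> (Suc N) * g (Suc N)"
      by (intro mult_left_mono increments \<phi>_nonneg)
    ultimately show ?case
      using Suc.IH by (simp add: W_def algebra_simps)
  qed
  show ?thesis
  proof (rule bounded_imp_summable)
    fix N
    have "\<phi> N * (G N - W N) \<ge> 0"
      using partial_sums[of N] \<phi>_nonneg by (simp add: W_def)
    moreover have "(\<Sum>n\<le>N. \<phi> n * g n) \<le> (\<Sum>n. \<phi> n * g n)"
      by (intro sum_le_suminf summable) (auto simp: \<phi>_nonneg g_nonneg)
    ultimately show "(\<Sum>n\<le>N. \<phi> n * w n) \<le> \<phi> 0 * G 0 + (\<Sum>n. \<phi> n * g n)"
      using abel[of N] by linarith
  qed (simp add: \<phi>_nonneg w_nonneg)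
qed

section \<open>Growth of the two bounds\<close>

lemma ln_Suc_diff_le:
  assumes "n \<ge> 1"
  shows "ln (real (Suc n)) - ln (real n) \<le> 1 / real n"
proof -
  have "ln (real (Suc n)) - ln (real n) = ln (1 + 1 / real n)"
    using assms by (simp add: ln_divide_pos[symmetric] add_divide_distrib add.commute)
  also have "\<dots> \<le> 1 / real n"
    by (rule ln_add_one_self_le_self) simp
  finally show ?thesis .
qed

lemma ln_squared_increment_le:
  assumes "n \<ge> 1"
  shows "(ln (real (Suc n)))\<^sup>2 - (ln (real n))\<^sup>2 \<le> 4 * ln (real (Suc n)) / real (Suc n)"
proof -
  have mono: "0 \<le> ln (real n)" "ln (real n) \<le> ln (real (Suc n))"
    using assms by auto
  have "(ln (real (Suc n)))\<^sup>2 - (ln (real n))\<^sup>2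
      = (ln (real (Suc n)) - ln (real n)) * (ln (real (Suc n)) + ln (real n))"
    by (simp add: power2_eq_square algebra_simps)
  also have "\<dots> \<le> (1 / real n) * (2 * ln (real (Suc n)))"
    using ln_Suc_diff_le[OF assms] mono by (intro mult_mono) auto
  also have "\<dots> \<le> (2 / real (Suc n)) * (2 * ln (real (Suc n)))"
    using assms mono by (intro mult_right_mono) (auto simp: field_simps)
  finally show ?thesis
    by simp
qed

lemma mult_ln_increment_le:
  assumes "n \<ge> 1"
  shows "real (Suc n) * ln (real (Suc n)) - real n * ln (real n) \<le> 3 * ln (real (Suc n))"
proof -
  have "real n * (ln (real (Suc n)) - ln (real n)) \<le> real n * (1 / real n)"
    by (intro mult_left_mono ln_Suc_diff_le assms) simp
  then have "real n * (ln (real (Suc n)) - ln (real n)) \<le> 1"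
    using assms by simp
  moreover have "1 \<le> 2 * ln (real (Suc n))"
  proof -
    have "ln 2 \<le> ln (real (Suc n))"
      using assms by simp
    then show ?thesis
      using ln2_ge_two_thirds by linarith
  qed
  ultimately show ?thesis
    by (simp add: algebra_simps)
qed

text \<open>
  The two conditions of the theorem are instances of the hypotheses here, with
  \<open>H N = (ln N)\<^sup>2\<close> and \<open>H N = N * ln N\<close>. Since \<open>H 1 = 0\<close> in each case, the bound \<open>C * H N\<close> can only be required from \<open>N = 2\<close> on.
\<close>

lemma summable_weighted_by_growth:
  fixes \<phi> w h H :: "nat \<Rightarrow> real"
  assumes antimono: "antimono_on {1..} \<phi>" and \<phi>_nonneg: "\<And>n. n \<ge> 1 \<Longrightarrow> \<phi> n \<ge> 0"
    and w_nonneg: "\<And>n. n \<ge> 1 \<Longrightarrow> w n \<ge> 0" and h_nonneg: "\<And>n. n \<ge> 1 \<Longrightarrow> h n \<ge> 0"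
    and "C > 0" and partial_sums: "\<And>N. N \<ge> 2 \<Longrightarrow> (\<Sum>n = 1..N. w n) \<le> C * H N"
    and H_one: "H 1 = 0"
    and increments: "\<And>n. n \<ge> 1 \<Longrightarrow> H (Suc n) - H n \<le> h (Suc n)"
    and summable: "summable (\<lambda>n. \<phi> (Suc n) * h (Suc n))"
  shows "summable (\<lambda>n. \<phi> (Suc n) * w (Suc n))"
proof (rule summable_antimono_weight)
  \<comment> \<open>The summand \<open>w 1\<close> makes the bound valid for \<open>N = 1\<close> and does not affect the increments.\<close>
  show "(\<Sum>n\<le>N. w (Suc n)) \<le> w 1 + C * H (Suc N)" for N
  proof (cases N)
    case 0
    then show ?thesis
      using H_one by simp
  next
    case (Suc m)
    have "(\<Sum>n\<le>N. w (Suc n)) = (\<Sum>n = 1..Suc N. w n)"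
      by (simp only: One_nat_def sum.atLeast1_atMost_eq lessThan_Suc_atMost)
    then show ?thesis
      using partial_sums[of "Suc N"] w_nonneg[of 1] Suc by simp
  qed
  show "(w 1 + C * H (Suc (Suc n))) - (w 1 + C * H (Suc n)) \<le> C * h (Suc (Suc n))" for n
    using mult_left_mono[OF increments[of "Suc n"], of C] \<open>C > 0\<close> by (simp add: algebra_simps)
  show "summable (\<lambda>n. \<phi> (Suc n) * (C * h (Suc n)))"
    using summable_mult[OF summable, of C] by (simp add: mult.left_commute)
  show "\<phi> (Suc (Suc n)) \<le> \<phi> (Suc n)" for n
    using antimono by (auto simp: monotone_on_def)
qed (use assms in auto)

section \<open>The convergence theorem\<close>

theorem theorem2p2:
  fixes \<alpha> \<gamma> \<delta> :: real and \<psi> :: "nat \<Rightarrow> real"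
  assumes "\<alpha> \<notin> \<rat>"
    and "\<And>n::nat. n \<ge> 1 \<Longrightarrow> dist_nearest_int (real n * \<alpha> - \<gamma>) > 0"
    and "\<And>n::nat. n \<ge> 1 \<Longrightarrow> \<psi> n > 0"
    and "summable (\<lambda>n. \<psi> (Suc n) * ln (real (Suc n)))"
    and "(antimono_on {1..} (\<lambda>n. real n * \<psi> n) \<and>
            (\<exists>C>0. \<forall>N\<ge>2. S_sum N \<alpha> \<gamma> \<le> C * (ln (real N))\<^sup>2)) \<or>
         (antimono_on {1..} \<psi> \<and>
            (\<exists>C>0. \<forall>N\<ge>2. R_sum N \<alpha> \<gamma> \<le> C * real N * ln (real N)))"
  shows "AE \<beta> in lebesgue. finite {n::nat. n \<ge> 1 \<and>
           dist_nearest_int (real n * \<alpha> - \<gamma>) * dist_nearest_int (real n * \<beta> - \<delta>) < \<psi> n}"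
proof -
  define d where "d n = dist_nearest_int (real n * \<alpha> - \<gamma>)" for n :: nat
  have d_pos: "d n > 0" if "n \<ge> 1" for n
    using assms(2)[OF that] by (simp add: d_def)
  have psi_pos: "\<psi> n > 0" if "n \<ge> 1" for n
    using assms(3)[OF that] .
  have "summable (\<lambda>n. \<psi> (Suc n) / d (Suc n))"
    using assms(5)
  proof (elim disjE conjE exE)
    fix C
    assume "antimono_on {1..} (\<lambda>n. real n * \<psi> n)" "C > 0"
      and S: "\<forall>N\<ge>2. S_sum N \<alpha> \<gamma> \<le> C * (ln (real N))\<^sup>2"
    have "summable (\<lambda>n. (real (Suc n) * \<psi> (Suc n)) * (1 / (real (Suc n) * d (Suc n))))"
    proof (rule summable_weighted_by_growth)
      show "(\<Sum>n = 1..N. 1 / (real n * d n)) \<le> C * (ln (real N))\<^sup>2" if "N \<ge> 2" for N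
        using S that by (simp add: S_sum_def d_def)
      show "(ln (real (Suc n)))\<^sup>2 - (ln (real n))\<^sup>2 \<le> 4 * ln (real (Suc n)) / real (Suc n)"
        if "n \<ge> 1" for n
        by (rule ln_squared_increment_le[OF that])
      show "summable (\<lambda>n. (real (Suc n) * \<psi> (Suc n)) * (4 * ln (real (Suc n)) / real (Suc n)))"
        using summable_mult[OF assms(4), of 4] by (simp add: mult_ac del: of_nat_Suc)
      show "antimono_on {1..} (\<lambda>n. real n * \<psi> n)" "C > 0"
        by fact+
    qed (use d_pos psi_pos in \<open>auto simp: less_imp_le\<close>)
    then show ?thesis
      by (simp del: of_nat_Suc)
  next
    fix C
    assume "antimono_on {1..} \<psi>" "C > 0"
      and R: "\<forall>N\<ge>2. R_sum N \<alpha> \<gamma> \<le> C * real N * ln (real N)"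
    have "summable (\<lambda>n. \<psi> (Suc n) * (1 / d (Suc n)))"
    proof (rule summable_weighted_by_growth)
      show "(\<Sum>n = 1..N. 1 / d n) \<le> C * (real N * ln (real N))" if "N \<ge> 2" for N
        using R that by (simp add: R_sum_def d_def mult.assoc)
      show "real (Suc n) * ln (real (Suc n)) - real n * ln (real n) \<le> 3 * ln (real (Suc n))"
        if "n \<ge> 1" for n
        by (rule mult_ln_increment_le[OF that])
      show "summable (\<lambda>n. \<psi> (Suc n) * (3 * ln (real (Suc n))))"
        using summable_mult[OF assms(4), of 3] by (simp add: mult_ac del: of_nat_Suc)
      show "antimono_on {1..} \<psi>" "C > 0"
        by fact+
    qed (use d_pos psi_pos in \<open>auto simp: less_imp_le\<close>)
    then show ?thesis
      by simp
  qed
  then have "AE \<beta> in lebesgue.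
      finite {n::nat. n \<ge> 1 \<and> dist_nearest_int (real n * \<beta> - \<delta>) < \<psi> n / d n}"
    using d_pos psi_pos
    by (intro AE_finite_inhomogeneous_approximations) (auto intro!: divide_nonneg_pos less_imp_le)
  moreover have "{n::nat. n \<ge> 1 \<and> dist_nearest_int (real n * \<beta> - \<delta>) < \<psi> n / d n}
      = {n::nat. n \<ge> 1 \<and> dist_nearest_int (real n * \<alpha> - \<gamma>) * dist_nearest_int (real n * \<beta> - \<delta>) < \<psi> n}"
    for \<beta>
    using d_pos by (auto simp: pos_less_divide_eq mult.commute d_def)
  ultimately show ?thesis
    by simp
qed

end
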